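(* Let $G$ be a graph (parallel edges allowed, no loops), let $\delta$ be an infinite cardinal, and let $a,b \in V(G)$ be two distinct vertices for which there are $\delta$ pairwise edge-disjoint $a{-}b$ paths each of length at most $p$, for some $p \in \mathbb{N}$. Then there exist $\delta$ pairwise edge-disjoint $a{-}b$ paths in $G$ that are pairwise order-compatible.
   Context: Graphs may have parallel edges but no loops. The length of a path is its number of edges. Two $a{-}b$ paths are order-compatible if their common vertices occur in the same order when travelling along each of them from $a$ to $b$. *)

theory Defs
  imports Main
begin

unbundle cardinal_syntax

record ('v, 'e) multigraph =
  verts :: "'v set"
  edges :: "'e set"
  ends :: "'e \<Rightarrow> 'v set"

text \<open>Edges are named objects with exactly two ends, so parallel edges are allowed and loops are
  not. Vertex set and edge set may be infinite.\<close>

definition wf_multigraph :: "('v, 'e) multigraph \<Rightarrow> bool" where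
  "wf_multigraph G \<longleftrightarrow> (\<forall>e \<in> edges G. ends G e \<subseteq> verts G \<and> card (ends G e) = 2)"

text \<open>A path, traversed from one of its ends to the other, is the pair of its vertex sequence and
  its edge sequence; the latter is needed because of parallel edges.\<close>

type_synonym ('v, 'e) mpath = "'v list \<times> 'e list"

abbreviation path_verts :: "('v, 'e) mpath \<Rightarrow> 'v list" where
  "path_verts \<equiv> fst"

abbreviation path_edges :: "('v, 'e) mpath \<Rightarrow> 'e list" where
  "path_edges \<equiv> snd"

definition path_between :: "('v, 'e) multigraph \<Rightarrow> 'v \<Rightarrow> 'v \<Rightarrow> ('v, 'e) mpath \<Rightarrow> bool" where
  "path_between G a b P \<longleftrightarrow>
     length (path_verts P) = Suc (length (path_edges P)) \<and>
     distinct (path_verts P) \<and>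
     set (path_verts P) \<subseteq> verts G \<and>
     set (path_edges P) \<subseteq> edges G \<and>
     (\<forall>i < length (path_edges P).
        ends G (path_edges P ! i) = {path_verts P ! i, path_verts P ! Suc i}) \<and>
     hd (path_verts P) = a \<and> last (path_verts P) = b"

definition path_length :: "('v, 'e) mpath \<Rightarrow> nat" where
  "path_length P = length (path_edges P)"

definition edge_disjoint :: "('v, 'e) mpath \<Rightarrow> ('v, 'e) mpath \<Rightarrow> bool" where
  "edge_disjoint P Q \<longleftrightarrow> set (path_edges P) \<inter> set (path_edges Q) = {}"

definition precedes_on :: "('v, 'e) mpath \<Rightarrow> 'v \<Rightarrow> 'v \<Rightarrow> bool" where
  "precedes_on P x y \<longleftrightarrow>
     (\<exists>i j. i < j \<and> j < length (path_verts P) \<and> path_verts P ! i = x \<and> path_verts P ! j = y)"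

definition order_compatible :: "('v, 'e) mpath \<Rightarrow> ('v, 'e) mpath \<Rightarrow> bool" where
  "order_compatible P Q \<longleftrightarrow>
     (\<forall>x \<in> set (path_verts P) \<inter> set (path_verts Q). \<forall>y \<in> set (path_verts P) \<inter> set (path_verts Q).
        precedes_on P x y \<longleftrightarrow> precedes_on Q x y)"

end

theory Submission
  imports Defs
begin

text \<open>
  It suffices to find \<open>\<delta>\<close> of the given paths, all of the same length, such that a vertex on two of
  them has the same position on both. Treating the finitely many pairs of positions one
  after the other, this reduces to a statement about two functions \<open>g\<close>, \<open>h\<close> that differ everywhere
  on an infinite set \<open>T\<close>: some subset of the same cardinality has disjoint images under \<open>g\<close> and \<open>h\<close>.

  To see this, take a maximal subset with disjoint images. If it is smaller than \<open>T\<close>, then the union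
  \<open>C\<close> of its images is small and every \<open>t\<close> has \<open>g t \<in> C\<close> or \<open>h t \<in> C\<close>. Splitting by which of the two
  values lie in \<open>C\<close>, the only interesting case is that both do, so that \<open>t \<mapsto> (g t, h t)\<close> has fewer
  than \<open>|T|\<close> fibres. If all fibres are smaller than \<open>T\<close>, there is a
  smaller index set whose every subset of full cardinality carries fibres of total size \<open>|T|\<close>, and
  induction on the cardinality applies to that index set.
\<close>

section \<open>Cardinalities below an infinite one\<close>

lemma card_of_finite_ordLess_infinite:
  assumes "finite A" and "infinite B"
  shows "|A| <o |B|"
  using assms by (intro finite_ordLess_infinite card_of_Well_order) (simp_all add: Field_card_of)

lemma card_of_Times_self_ordLess:
  assumes "infinite B" and "|A| <o |B|"
  shows "|A \<times> A| <o |B|"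
proof (cases "finite A")
  case True
  with assms(1) show ?thesis by (intro card_of_finite_ordLess_infinite) auto
next
  case False
  then show ?thesis by (intro ordIso_ordLess_trans[OF card_of_Times_same_infinite assms(2)])
qed

lemma card_of_UN_finite_ordLess:
  assumes "infinite B" and "finite I" and "\<And>i. i \<in> I \<Longrightarrow> |A i| <o |B|"
  shows "|\<Union>i\<in>I. A i| <o |B|"
  using assms(2,3)
proof (induction I)
  case empty
  then show ?case using assms(1) card_of_finite_ordLess_infinite[of "{}" B] by simp
next
  case (insert i I)
  then have "|A i \<union> \<Union> (A ` I)| <o |B|" by (intro card_of_Un_ordLess_infinite[OF assms(1)]) auto
  then show ?case by simp
qed

lemma card_of_Un_ordIso_cases:
  assumes "infinite T" and "T = A \<union> B"
  shows "|A| =o |T| \<or> |B| =o |T|"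
proof (rule ccontr)
  assume "\<not> ?thesis"
  moreover have "|A| \<le>o |T|" "|B| \<le>o |T|" using assms(2) by (auto intro: card_of_mono1)
  ultimately have "|A| <o |T|" "|B| <o |T|" by (auto simp: ordLeq_iff_ordLess_or_ordIso)
  from card_of_Un_ordLess_infinite[OF assms(1) this] show False
    using assms(2) ordLess_irreflexive by blast
qed

lemma card_of_subset_ordLess:
  assumes "A \<subseteq> T" and "\<not> |A| =o |T|"
  shows "|A| <o |T|"
  using assms card_of_mono1[OF assms(1)] by (auto simp: ordLeq_iff_ordLess_or_ordIso)

section \<open>Maximal sets and sets of minimal cardinality\<close>

text \<open>Zorn's lemma applies because any two points of the union of a chain lie in one common
  member, where their values under \<open>g\<close> and \<open>h\<close> already differ.\<close>

lemma ex_maximal_disjoint_images: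
  "\<exists>M\<subseteq>T. g ` M \<inter> h ` M = {} \<and> (\<forall>N\<subseteq>T. g ` N \<inter> h ` N = {} \<longrightarrow> M \<subseteq> N \<longrightarrow> N = M)"
proof -
  define D where "D M \<longleftrightarrow> M \<subseteq> T \<and> (\<forall>x\<in>M. \<forall>y\<in>M. g x \<noteq> h y)" for M
  have D_iff: "D M \<longleftrightarrow> M \<subseteq> T \<and> g ` M \<inter> h ` M = {}" for M
    unfolding D_def by (simp add: disjoint_iff_not_equal)
  have "\<exists>M\<in>Collect D. \<forall>N\<in>Collect D. M \<subseteq> N \<longrightarrow> N = M"
  proof (rule subset_Zorn')
    fix \<C> assume chain: "subset.chain (Collect D) \<C>"
    have D: "D X" if "X \<in> \<C>" for X
      using chain that unfolding subset_chain_def by auto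
    have "g x \<noteq> h y" if xy: "x \<in> X" "X \<in> \<C>" "y \<in> Y" "Y \<in> \<C>" for x y X Y
    proof -
      have "X \<subseteq> Y \<or> Y \<subseteq> X" using chain that(2,4) unfolding subset_chain_def by meson
      then obtain Z where "Z \<in> \<C>" "x \<in> Z" "y \<in> Z" using xy by (meson subsetD)
      then show ?thesis using D[of Z] unfolding D_def by simp
    qed
    moreover have "\<Union>\<C> \<subseteq> T" using D unfolding D_def by (meson Union_least)
    ultimately show "\<Union>\<C> \<in> Collect D" unfolding D_def by (simp only: mem_Collect_eq Union_iff Ball_def) meson
  qed
  then show ?thesis unfolding D_iff by (simp only: Bex_def Ball_def mem_Collect_eq) meson
qed

text \<open>Cardinals are well-founded under \<open><o\<close>. The bound by \<open>|A|\<close>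
  holds since otherwise \<open>A\<close> itself would be a smaller set with
  \<open>P\<close>.\<close>

lemma ex_minimal_card_subset:
  assumes "P (A :: 'a set)"
  shows "\<exists>S. P S \<and> |S| \<le>o |A| \<and> (\<forall>R. |R| <o |S| \<longrightarrow> \<not> P R)"
proof -
  have "wf (inv_image ordLess (\<lambda>S :: 'a set. |S| ))" by (rule wf_inv_image[OF wf_ordLess])
  from wfE_min'[OF this, of "{S. P S}"] assms
  obtain S where S: "P S" "\<And>R. |R| <o |S| \<Longrightarrow> \<not> P R"
    by (auto simp: inv_image_def)
  have "|S| \<le>o |A|" using S(2)[of A] assms by (metis not_ordLeq_iff_ordLess card_of_Well_order)
  with S show ?thesis by blast
qed

section \<open>Initial segments and small index sets\<close>

text \<open>The cardinal \<open>|S|\<close> is used as a well-order on \<open>S\<close>. A subset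
  with no element at or above \<xi> lies in the initial segment strictly below \<xi>, which is
  smaller than \<open>S\<close>.\<close>

lemma full_card_subset_cofinal:
  assumes "X \<subseteq> S" and "|X| =o |S|" and "\<xi> \<in> S"
  shows "\<exists>x\<in>X. under |S| \<xi> \<subseteq> under |S| x"
proof (rule ccontr)
  assume no: "\<not> ?thesis"
  have wo: "Well_order |S|" by (rule card_of_Well_order)
  have fld: "Field |S| = S" by (rule Field_card_of)
  have tr: "trans |S|" and tot: "Total |S|" and refl: "Refl |S|"
    using wo by (simp_all add: order_on_defs)
  have "X \<subseteq> underS |S| \<xi>"
  proof
    fix x assume x: "x \<in> X"
    with no have nle: "(\<xi>, x) \<notin> |S|" using tr unfolding under_def by (blast dest: transD)
    have "(x, \<xi>) \<in> |S| \<and> x \<noteq> \<xi>"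
      using nle tot refl x assms(1,3) fld unfolding total_on_def refl_on_def by (metis subsetD)
    then show "x \<in> underS |S| \<xi>" unfolding underS_def by simp
  qed
  then have "|X| \<le>o |underS |S| \<xi>|" by (rule card_of_mono1)
  also have "|underS |S| \<xi>| <o |S|"
    using card_of_underS[OF card_of_Card_order, of \<xi> S] assms(3) fld by simp
  finally show False using assms(2) not_ordLess_ordIso[of "|X|" "|S|"] by simp
qed

lemma card_of_under_ordLess:
  assumes "infinite S" and "\<xi> \<in> S"
  shows "|under |S| \<xi>| <o |S|"
proof -
  have "|underS |S| \<xi>| <o |S|"
    using card_of_underS[OF card_of_Card_order, of \<xi> S] assms(2) by (simp add: Field_card_of)
  moreover have "|{\<xi>}| <o |S|" using assms(1) by (intro card_of_finite_ordLess_infinite) auto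
  ultimately have "|underS |S| \<xi> \<union> {\<xi>}| <o |S|"
    by (rule card_of_Un_ordLess_infinite[OF assms(1)])
  moreover have "under |S| \<xi> \<subseteq> underS |S| \<xi> \<union> {\<xi>}" unfolding under_def underS_def by auto
  ultimately show ?thesis using ordLeq_ordLess_trans[OF card_of_mono1] by metis
qed

text \<open>Applied to the fibres of a function with few values, this replaces a cofinal sequence in the
  (possibly singular) cardinal of \<open>T\<close>; no case distinction on regularity is needed.\<close>

lemma ex_small_index_set:
  fixes T :: "'t set" and F :: "'t \<Rightarrow> 't set"
  assumes inf: "infinite T" and R: "|R| <o |T|" "R \<subseteq> T" "(\<Union>t\<in>R. F t) = T"
    and F: "\<And>t. t \<in> T \<Longrightarrow> F t \<subseteq> T \<and> |F t| <o |T|"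
  obtains S :: "'t set" and d where "infinite S" "|S| <o |T|" "d ` S \<subseteq> T"
    "\<And>X. X \<subseteq> S \<Longrightarrow> |X| =o |S| \<Longrightarrow> |\<Union>x\<in>X. F (d x)| =o |T|"
proof -
  let ?P = "\<lambda>S. S \<subseteq> T \<and> |\<Union>t\<in>S. F t| =o |T|"
  have "?P R" using R(2,3) card_of_refl[of T] by simp
  from ex_minimal_card_subset[of ?P, OF this]
  obtain S where S: "S \<subseteq> T" "|\<Union>t\<in>S. F t| =o |T|" "|S| \<le>o |R|"
    and min: "\<And>Q. |Q| <o |S| \<Longrightarrow> Q \<subseteq> T \<Longrightarrow> \<not> |\<Union>t\<in>Q. F t| =o |T|" by blast
  have ST: "|S| <o |T|" by (rule ordLeq_ordLess_trans[OF S(3) R(1)])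
  have infS: "infinite S"
  proof
    assume "finite S"
    then have "|\<Union>t\<in>S. F t| <o |T|" using S(1) F by (intro card_of_UN_finite_ordLess[OF inf]) auto
    then show False using S(2) not_ordLess_ordIso[of "|\<Union>t\<in>S. F t|" "|T|"] by simp
  qed
  \<comment> \<open>\<open>M \<xi>\<close> grows with \<xi> and exhausts the union over
    \<open>S\<close>, yet each \<open>M \<xi>\<close> is smaller than \<open>T\<close> by the
    minimality of \<open>S\<close>.\<close>
  define M where "M \<xi> = (\<Union>\<eta>\<in>under |S| \<xi>. F \<eta>)" for \<xi>
  have underS: "under |S| \<xi> \<subseteq> S" for \<xi>
    using under_Field[of "|S|" \<xi>] by (simp add: Field_card_of)
  have M: "|M \<xi>| <o |T|" if "\<xi> \<in> S" for \<xi>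
  proof (rule card_of_subset_ordLess)
    show "M \<xi> \<subseteq> T" unfolding M_def using underS S(1) F by blast
    show "\<not> |M \<xi>| =o |T|" unfolding M_def
      using min[OF card_of_under_ordLess[OF infS that]] underS S(1) by blast
  qed
  \<comment> \<open>Otherwise the sets \<open>F t\<close> with \<open>t\<close> in \<open>R\<close>,
    which cover \<open>T\<close>, would have a union of size at most \<open>|?B|\<close>. In
    \<open>?B\<close>, the set \<open>S\<close> ensures infinity and \<open>R\<close> bounds the
    number of sets.\<close>
  have "\<exists>t\<in>T. |M \<xi>| \<le>o |F t|" if "\<xi> \<in> S" for \<xi>
  proof (rule ccontr)
    assume no: "\<not> ?thesis"
    let ?B = "M \<xi> \<union> S \<union> R"
    have B: "|?B| <o |T|" by (intro card_of_Un_ordLess_infinite inf M that ST R)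
    have "|\<Union>t\<in>R. F t| \<le>o |?B|"
    proof (rule card_of_UNION_ordLeq_infinite)
      show "infinite ?B" using infS by simp
      show "|R| \<le>o |?B|" by (rule card_of_mono1) simp
      show "\<forall>t\<in>R. |F t| \<le>o |?B|"
      proof
        fix t assume "t \<in> R"
        then have "|F t| \<le>o |M \<xi>|"
          using no R(2) ordLeq_total[OF card_of_Well_order card_of_Well_order, of "F t" "M \<xi>"] by auto
        also have "|M \<xi>| \<le>o |?B|" by (rule card_of_mono1) blast
        finally show "|F t| \<le>o |?B|" .
      qed
    qed
    then show False using B R(3) not_ordLess_ordLeq[OF B] by simp
  qed
  then obtain d where d: "\<And>\<xi>. \<xi> \<in> S \<Longrightarrow> d \<xi> \<in> T \<and> |M \<xi>| \<le>o |F (d \<xi>)|" by metis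
  \<comment> \<open>\<open>X\<close> is cofinal in \<open>S\<close>, so each \<open>M \<xi>\<close>
    lies in some \<open>M x\<close> with \<open>x\<close> in \<open>X\<close> and thus injects into
    \<open>F (d x)\<close>, a part of \<open>?U\<close>. Were \<open>?U\<close> smaller than
    \<open>T\<close>, so would be the union of all \<open>M \<xi>\<close>.\<close>
  have "|\<Union>x\<in>X. F (d x)| =o |T|" if X: "X \<subseteq> S" "|X| =o |S|" for X
  proof (rule ccontr)
    let ?U = "\<Union>x\<in>X. F (d x)"
    let ?B = "?U \<union> S"
    assume "\<not> |?U| =o |T|"
    moreover have "?U \<subseteq> T" using d F X(1) by blast
    ultimately have "|?U| <o |T|" by (intro card_of_subset_ordLess)
    then have B: "|?B| <o |T|" by (intro card_of_Un_ordLess_infinite inf ST)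
    have "|\<Union>\<xi>\<in>S. M \<xi>| \<le>o |?B|"
    proof (rule card_of_UNION_ordLeq_infinite)
      show "infinite ?B" using infS by simp
      show "|S| \<le>o |?B|" by (rule card_of_mono1) simp
      show "\<forall>\<xi>\<in>S. |M \<xi>| \<le>o |?B|"
      proof
        fix \<xi> assume "\<xi> \<in> S"
        with full_card_subset_cofinal[OF X] obtain x where
          x: "x \<in> X" "under |S| \<xi> \<subseteq> under |S| x" by blast
        have "|M \<xi>| \<le>o |M x|" unfolding M_def using x(2) by (intro card_of_mono1) blast
        also have "|M x| \<le>o |F (d x)|" using d x(1) X(1) by blast
        also have "|F (d x)| \<le>o |?B|" using x(1) by (intro card_of_mono1) blast
        finally show "|M \<xi>| \<le>o |?B|" .
      qed
    qed
    moreover have "(\<Union>\<xi>\<in>S. F \<xi>) \<subseteq> (\<Union>\<xi>\<in>S. M \<xi>)"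
    proof -
      have "\<xi> \<in> under |S| \<xi>" if "\<xi> \<in> S" for \<xi>
        using that card_of_Well_order[of S] unfolding under_def
        by (auto simp: order_on_defs refl_on_def Field_card_of)
      then show ?thesis unfolding M_def by blast
    qed
    ultimately have "|\<Union>\<xi>\<in>S. F \<xi>| \<le>o |?B|" by (meson card_of_mono1 ordLeq_transitive)
    then have "|\<Union>\<xi>\<in>S. F \<xi>| <o |T|" by (rule ordLeq_ordLess_trans[OF _ B])
    then show False using S(2) not_ordLess_ordIso[of "|\<Union>\<xi>\<in>S. F \<xi>|" "|T|"] by simp
  qed
  with that[OF infS ST, of d] d show thesis by blast
qed

section \<open>Disjoint images on subsets of full cardinality\<close>

lemma ex_full_card_disjoint_images:
  fixes T :: "'t set" and g h :: "'t \<Rightarrow> 'v"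
  assumes "infinite T" and "\<And>t. t \<in> T \<Longrightarrow> g t \<noteq> h t"
  shows "\<exists>T'\<subseteq>T. |T'| =o |T| \<and> g ` T' \<inter> h ` T' = {}"
proof -
  have "wf (inv_image ordLess (\<lambda>T :: 't set. |T| ))" by (rule wf_inv_image[OF wf_ordLess])
  then show ?thesis using assms
  \<comment> \<open>\<open>g\<close> and \<open>h\<close> vary because the induction hypothesis is
    applied to their composites with an index map \<open>d\<close>.\<close>
  proof (induction T arbitrary: g h rule: wf_induct_rule)
    case (less T)
    note inf = less.prems(1) and neq = less.prems(2)
    have IH: "\<exists>S'\<subseteq>S. |S'| =o |S| \<and> g' ` S' \<inter> h' ` S' = {}"
      if "|S| <o |T|" "infinite S" "\<And>t. t \<in> S \<Longrightarrow> g' t \<noteq> h' t" for S and g' h' :: "'t \<Rightarrow> 'v"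
      using less.IH[of S g' h'] that by (simp add: inv_image_def)
    obtain M where M: "M \<subseteq> T" "g ` M \<inter> h ` M = {}"
      and max: "\<And>N. N \<subseteq> T \<Longrightarrow> g ` N \<inter> h ` N = {} \<Longrightarrow> M \<subseteq> N \<Longrightarrow> N = M"
      using ex_maximal_disjoint_images[of T g h] by blast
    show ?case
    proof (cases "|M| =o |T|")
      case True
      with M show ?thesis by blast
    next
      case False
      then have MT: "|M| <o |T|" using M(1) by (intro card_of_subset_ordLess)
      define C where "C = g ` M \<union> h ` M"
      have "|g ` M| <o |T|" "|h ` M| <o |T|"
        by (rule ordLeq_ordLess_trans[OF card_of_image MT])+
      then have CT: "|C| <o |T|" unfolding C_def by (intro card_of_Un_ordLess_infinite inf)
      \<comment> \<open>For \<open>t\<close> outside \<open>M\<close>, maximality makes the images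
        of \<open>insert t M\<close> meet. As \<open>g t \<noteq> h t\<close> and the images of
        \<open>M\<close> are disjoint, a value at \<open>t\<close> meets a value on
        \<open>M\<close>.\<close>
      have meets: "g t \<in> C \<or> h t \<in> C" if "t \<in> T" for t
      proof (cases "t \<in> M")
        case True
        then show ?thesis unfolding C_def by blast
      next
        case False
        with max[of "insert t M"] that M(1) have "g ` insert t M \<inter> h ` insert t M \<noteq> {}" by blast
        with M(2) neq[OF that] show ?thesis unfolding C_def by auto
      qed
      define T1 where "T1 = {t \<in> T. g t \<in> C \<and> h t \<notin> C}"
      define T2 where "T2 = {t \<in> T. g t \<notin> C \<and> h t \<in> C}"
      define T3 where "T3 = {t \<in> T. g t \<in> C \<and> h t \<in> C}"
      have "T = T1 \<union> (T2 \<union> T3)" unfolding T1_def T2_def T3_def using meets by auto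
      from card_of_Un_ordIso_cases[OF inf this]
      consider "|T1| =o |T|" | "|T2 \<union> T3| =o |T|" by blast
      then show ?thesis
      proof cases
        case 1
        moreover have "T1 \<subseteq> T" "g ` T1 \<inter> h ` T1 = {}" unfolding T1_def by auto
        ultimately show ?thesis by blast
      next
        case 2
        then have "infinite (T2 \<union> T3)" using inf card_of_ordIso_finite[OF 2] by simp
        from card_of_Un_ordIso_cases[OF this refl] 2
        consider "|T2| =o |T|" | "|T3| =o |T|" by (meson ordIso_transitive)
        then show ?thesis
        proof cases
          case 1
          moreover have "T2 \<subseteq> T" "g ` T2 \<inter> h ` T2 = {}" unfolding T2_def by auto
          ultimately show ?thesis by blast
        next
          case 2
          then have inf3: "infinite T3" using inf card_of_ordIso_finite[OF 2] by simp
          define f where "f t = (g t, h t)" for t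
          define F where "F t = {s \<in> T3. f s = f t}" for t
          \<comment> \<open>One representative for each fibre of \<open>f\<close>: the indices lie
            in \<open>T3\<close>, and there are at most \<open>|C \<times> C|\<close> of
            them.\<close>
          define R where "R = inv_into T3 f ` f ` T3"
          have T3: "T3 \<subseteq> T" unfolding T3_def by blast
          have CC: "|C \<times> C| <o |T3|"
          proof -
            have "|C| <o |T3|" by (rule ordLess_ordIso_trans[OF CT ordIso_symmetric[OF 2]])
            then show ?thesis by (rule card_of_Times_self_ordLess[OF inf3])
          qed
          have "|R| \<le>o |f ` T3|" unfolding R_def by (rule card_of_image)
          also have "|f ` T3| \<le>o |C \<times> C|" by (rule card_of_mono1) (auto simp: f_def T3_def)
          finally have RT: "|R| <o |T3|" by (rule ordLeq_ordLess_trans[OF _ CC])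
          have RT3: "R \<subseteq> T3" unfolding R_def by (auto intro: inv_into_into)
          have cover: "(\<Union>t\<in>R. F t) = T3"
            unfolding R_def F_def by (auto simp: f_inv_into_f)
          show ?thesis
          proof (cases "\<exists>t\<in>T3. |F t| =o |T3|")
            case True
            then obtain t where t: "t \<in> T3" "|F t| =o |T3|" by blast
            \<comment> \<open>On \<open>F t\<close> both functions are constant, with distinct
              values \<open>g t\<close> and \<open>h t\<close>.\<close>
            have "g ` F t \<inter> h ` F t = {}" using neq[of t] t(1) T3 unfolding F_def f_def by auto
            moreover have "|F t| =o |T|" by (rule ordIso_transitive[OF t(2) 2])
            moreover have "F t \<subseteq> T" using T3 unfolding F_def by blast
            ultimately show ?thesis by blast
          next
            case False
            have FT: "F t \<subseteq> T3 \<and> |F t| <o |T3|" if "t \<in> T3" for t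
            proof
              show "F t \<subseteq> T3" unfolding F_def by blast
              then show "|F t| <o |T3|" using False that by (intro card_of_subset_ordLess) auto
            qed
            obtain S :: "'t set" and d where S: "infinite S" "|S| <o |T3|" "d ` S \<subseteq> T3"
              and full: "\<And>X. X \<subseteq> S \<Longrightarrow> |X| =o |S| \<Longrightarrow> |\<Union>x\<in>X. F (d x)| =o |T3|"
              using ex_small_index_set[OF inf3 RT RT3 cover FT] by blast
            have "|S| <o |T|" by (rule ordLess_ordIso_trans[OF S(2) 2])
            moreover have "(g \<circ> d) s \<noteq> (h \<circ> d) s" if "s \<in> S" for s
              using that S(3) T3 neq by auto
            ultimately obtain X where X: "X \<subseteq> S" "|X| =o |S|"
              "(g \<circ> d) ` X \<inter> (h \<circ> d) ` X = {}"
              using IH[of S "g \<circ> d" "h \<circ> d"] S(1) by blast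
            let ?U = "\<Union>x\<in>X. F (d x)"
            \<comment> \<open>On \<open>F (d x)\<close> both functions take only their values at
              \<open>d x\<close>, so disjointness over \<open>X\<close> carries over to the whole
              union.\<close>
            have "g ` ?U \<subseteq> (g \<circ> d) ` X" "h ` ?U \<subseteq> (h \<circ> d) ` X"
              unfolding F_def f_def by auto
            then have "g ` ?U \<inter> h ` ?U = {}" using X(3) by blast
            moreover have "|?U| =o |T|" by (rule ordIso_transitive[OF full[OF X(1,2)] 2])
            moreover have "?U \<subseteq> T" using T3 unfolding F_def by blast
            ultimately show ?thesis by blast
          qed
        qed
      qed
    qed
  qed
qed

text \<open>Disjointness of images passes to subsets, so shrinking \<open>T\<close> for one index
  after another loses nothing already achieved.\<close>

lemma ex_full_card_disjoint_images_family:
  assumes "finite I" and "infinite T"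
    and "\<And>i t. i \<in> I \<Longrightarrow> t \<in> T \<Longrightarrow> g i t \<noteq> h i t"
  shows "\<exists>T'\<subseteq>T. |T'| =o |T| \<and> (\<forall>i\<in>I. g i ` T' \<inter> h i ` T' = {})"
  using assms(1,3)
proof (induction I)
  case empty
  then show ?case using card_of_refl[of T] by blast
next
  case (insert i I)
  then obtain T' where T': "T' \<subseteq> T" "|T'| =o |T|" "\<forall>i\<in>I. g i ` T' \<inter> h i ` T' = {}" by blast
  then have "infinite T'" using assms(2) card_of_ordIso_finite[OF T'(2)] by simp
  moreover have "g i t \<noteq> h i t" if "t \<in> T'" for t using insert.prems T'(1) that by blast
  ultimately obtain T'' where T'': "T'' \<subseteq> T'" "|T''| =o |T'|" "g i ` T'' \<inter> h i ` T'' = {}"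
    using ex_full_card_disjoint_images[of T' "g i" "h i"] by blast
  have "\<forall>j\<in>insert i I. g j ` T'' \<inter> h j ` T'' = {}" using T'(3) T''(1,3) by blast
  moreover have "T'' \<subseteq> T" using T'(1) T''(1) by blast
  moreover have "|T''| =o |T|" by (rule ordIso_transitive[OF T''(2) T'(2)])
  ultimately show ?case by blast
qed

text \<open>Otherwise \<open>T\<close> would be a finite union of smaller sets.\<close>

lemma ex_full_card_fibre:
  assumes "infinite T" and "finite (f ` T)"
  shows "\<exists>c. |{t \<in> T. f t = c}| =o |T|"
proof (rule ccontr)
  assume no: "\<not> ?thesis"
  have "|{t \<in> T. f t = c}| <o |T|" for c
    using no by (intro card_of_subset_ordLess) auto
  from card_of_UN_finite_ordLess[OF assms this]
  have "|\<Union>c\<in>f ` T. {t \<in> T. f t = c}| <o |T|" .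
  moreover have "(\<Union>c\<in>f ` T. {t \<in> T. f t = c}) = T" by auto
  ultimately show False using ordLess_irreflexive by metis
qed

section \<open>From positions on paths to order-compatibility\<close>

text \<open>Each common vertex has a single index, the same on both paths, so both precedence
  relations compare the same two indices.\<close>

lemma order_compatibleI_same_positions:
  assumes "distinct (path_verts P)" "distinct (path_verts Q)"
    and same: "\<And>i j. i < length (path_verts P) \<Longrightarrow> j < length (path_verts Q) \<Longrightarrow>
       path_verts P ! i = path_verts Q ! j \<Longrightarrow> i = j"
  shows "order_compatible P Q"
proof -
  have "precedes_on P x y \<longleftrightarrow> precedes_on Q x y"
    if "x \<in> set (path_verts P) \<inter> set (path_verts Q)" "y \<in> set (path_verts P) \<inter> set (path_verts Q)"
    for x y
  proof -
    from that same obtain i j where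
      i: "i < length (path_verts P)" "i < length (path_verts Q)"
        "path_verts P ! i = x" "path_verts Q ! i = x" and
      j: "j < length (path_verts P)" "j < length (path_verts Q)"
        "path_verts P ! j = y" "path_verts Q ! j = y"
      by (metis IntE in_set_conv_nth)
    have "precedes_on P x y \<longleftrightarrow> i < j"
      unfolding precedes_on_def using assms(1) i j
      by (metis nth_eq_iff_index_eq order_less_trans)
    moreover have "precedes_on Q x y \<longleftrightarrow> i < j"
      unfolding precedes_on_def using assms(2) i j
      by (metis nth_eq_iff_index_eq order_less_trans)
    ultimately show ?thesis by simp
  qed
  then show ?thesis unfolding order_compatible_def by blast
qed

theorem theorem1p1:
  fixes G :: "('v, 'e) multigraph"
    and \<delta> :: "'d rel"
    and a b :: 'v
    and p :: nat
  assumes "wf_multigraph G"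
    and "Card_order \<delta>" and "cinfinite \<delta>"
    and "a \<in> verts G" and "b \<in> verts G" and "a \<noteq> b"
    and "\<exists>\<P> :: ('v, 'e) mpath set.
           |\<P>| =o \<delta> \<and>
           (\<forall>P \<in> \<P>. path_between G a b P \<and> path_length P \<le> p) \<and>
           pairwise edge_disjoint \<P>"
  shows "\<exists>\<Q> :: ('v, 'e) mpath set.
           |\<Q>| =o \<delta> \<and>
           (\<forall>Q \<in> \<Q>. path_between G a b Q) \<and>
           pairwise edge_disjoint \<Q> \<and>
           pairwise order_compatible \<Q>"
proof -
  obtain \<P> :: "('v, 'e) mpath set" where card: "|\<P>| =o \<delta>"
    and path: "\<And>P. P \<in> \<P> \<Longrightarrow> path_between G a b P \<and> path_length P \<le> p"
    and disj: "pairwise edge_disjoint \<P>"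
    using assms(7) by blast
  have inf: "infinite \<P>"
    using card_of_ordIso_finite_Field[OF assms(2) ordIso_symmetric[OF card]] assms(3)
    unfolding cinfinite_def by simp
  have "finite (path_length ` \<P>)"
    using path by (intro finite_subset[OF _ finite_atMost[of p]]) auto
  from ex_full_card_fibre[OF inf this] obtain n
    where n: "|{P \<in> \<P>. path_length P = n}| =o |\<P>|" by blast
  \<comment> \<open>With a common length \<open>n\<close>, the positions \<open>0\<close> to
    \<open>n\<close> exist on every path and can be read off as functions on
    \<open>\<P>'\<close>.\<close>
  define \<P>' where "\<P>' = {P \<in> \<P>. path_length P = n}"
  have inf': "infinite \<P>'" using inf card_of_ordIso_finite[OF n] unfolding \<P>'_def by simp
  have verts: "length (path_verts P) = Suc n \<and> distinct (path_verts P)" if "P \<in> \<P>'" for P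
    using that path unfolding \<P>'_def path_between_def path_length_def by auto
  \<comment> \<open>An index \<open>(i, j)\<close> stands for the functions reading positions
    \<open>i\<close> and \<open>j\<close>; they differ on every path in \<open>\<P>'\<close> because
    its vertices are distinct.\<close>
  define I where "I = {(i, j). i \<le> n \<and> j \<le> n \<and> i \<noteq> j}"
  have "finite I" unfolding I_def
    by (rule finite_subset[of _ "{..n} \<times> {..n}"]) auto
  moreover have "path_verts P ! fst ij \<noteq> path_verts P ! snd ij" if "ij \<in> I" "P \<in> \<P>'" for ij P
    using that verts[of P] unfolding I_def by (auto simp: nth_eq_iff_index_eq)
  ultimately obtain \<Q> where \<Q>: "\<Q> \<subseteq> \<P>'" "|\<Q>| =o |\<P>'|"
    and sep: "\<forall>ij\<in>I. (\<lambda>P. path_verts P ! fst ij) ` \<Q> \<inter> (\<lambda>P. path_verts P ! snd ij) ` \<Q> = {}"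
    using ex_full_card_disjoint_images_family[OF _ inf',
        of I "\<lambda>ij P. path_verts P ! fst ij" "\<lambda>ij P. path_verts P ! snd ij"] by blast
  have "order_compatible P Q" if PQ: "P \<in> \<Q>" "Q \<in> \<Q>" for P Q
  proof (rule order_compatibleI_same_positions)
    have *: "P \<in> \<P>'" "Q \<in> \<P>'" using PQ \<Q>(1) by auto
    show "distinct (path_verts P)" "distinct (path_verts Q)" using * verts by auto
    fix i j assume ij: "i < length (path_verts P)" "j < length (path_verts Q)"
      "path_verts P ! i = path_verts Q ! j"
    show "i = j"
    proof (rule ccontr)
      assume "i \<noteq> j"
      with ij * verts have "(i, j) \<in> I" unfolding I_def by auto
      \<comment> \<open>The shared vertex would lie in the images of \<open>\<Q>\<close> under both
        position functions for \<open>(i, j)\<close>.\<close>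
      from bspec[OF sep this] PQ ij(3) show False by auto
    qed
  qed
  then have "pairwise order_compatible \<Q>" unfolding pairwise_def by blast
  moreover have "\<Q> \<subseteq> \<P>" using \<Q>(1) unfolding \<P>'_def by blast
  moreover have "|\<Q>| =o \<delta>"
    using ordIso_transitive[OF ordIso_transitive[OF \<Q>(2)[unfolded \<P>'_def] n] card] .
  ultimately show ?thesis using path pairwise_subset[OF disj] by blast
qed

end
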